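(* Let $N$ be the number of block indices selected per iteration by the BOMMP algorithm ($1\le N\le K$). For any given positive integer $K$, there are a block $K$-sparse signal $x$ and a matrix $A$ satisfying $$\delta_{NK+1}=\frac{1}{\sqrt{\frac{K}{N}+1}}$$ such that the BOMMP algorithm may fail (to recover $x$ from $y=Ax$).
   Context: Block structure. A block structure $\mathcal{I}=\{d_1,\dots,d_l\}$ consists of positive integers $d_1,\dots,d_l$; put $n=\sum_{i=1}^l d_i$. A vector $x\in\mathbb{R}^n$ is viewed as a concatenation of consecutive blocks $x[1],\dots,x[l]$ with $x[i]\in\mathbb{R}^{d_i}$; a matrix $A\in\mathbb{R}^{m\times n}$ is correspondingly a concatenation of column blocks $A[1],\dots,A[l]$ with $A[i]\in\mathbb{R}^{m\times d_i}$. The block support of $x$ is $T=\text{block-supp}(x)=\{i:\|x[i]\|_2>0\}$, and $x$ is block $K$-sparse (over $\mathcal{I}$) if $|T|\le K$. For $\Gamma\subseteq\{1,\dots,l\}$, $A_\Gamma$ is the submatrix of $A$ formed by the column blocks $A[i]$, $i\in\Gamma$. The prime denotes transpose. Block-RIP. $A$ satisfies the block-RIP of order $K$ if there is $\delta\in[0,1)$ with $(1-\delta)\|x\|_2^2\le\|Ax\|_2^2\le(1+\delta)\|x\|_2^2$ for all block $K$-sparse $x$ over $\mathcal{I}$; the smallest such $\delta$ is the block restricted isometry constant (block-RIC) $\delta_K=\delta_{K|\mathcal{I}}$. Thus $\delta_{NK+1}$ is the block-RIC of order $NK+1$ of $A$. BOMMP (block orthogonal multi-matching pursuit) algorithm.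 Input: $y\in\mathbb{R}^m$, $A\in\mathbb{R}^{m\times n}$, block sparsity level $K$, number $N\ge 1$ of indices per selection ($N\le K$ and $N\le m/K$); $\epsilon$ denotes the stopping tolerance ($\epsilon=0$ in the noiseless case $y=Ax$ considered here). Initialize $k=0$, $r^0=y$, $\Lambda^0=\varnothing$. While $\|r^k\|_2>\epsilon$ and $k<\min\{K,\frac{m}{K}\}$, set $k=k+1$ and perform: (identification) select the set $T^k$ of $N$ block indices corresponding to the $N$ largest values of $\|A'[i]r^{k-1}\|_2$, $i=1,\dots,l$, where $A'[i]=(A[i])'$; (augmentation) $\Lambda^k=\Lambda^{k-1}\cup T^k$; (estimation) $\hat{x}_{\Lambda^k}=\arg\min_u\|y-A_{\Lambda^k}u\|_2$; (residual update) $r^k=y-A_{\Lambda^k}\hat{x}_{\Lambda^k}$. Output: $\hat{x}=\arg\min_{u:\,\text{block-supp}(u)=\Lambda^k}\|y-Au\|_2$. *)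

theory Defs
  imports Complex_Main "Jordan_Normal_Form.DL_Submatrix"
begin

definition l2norm :: "real vec \<Rightarrow> real" where
  "l2norm x = sqrt (x \<bullet> x)"

(* Block structure {d_1, ..., d_l}: the list ds of block sizes, with l = length ds and n = sum_list ds.
   Blocks, rows and columns are numbered from 0. *)

definition block_structure :: "nat list \<Rightarrow> bool" where
  "block_structure ds \<longleftrightarrow> (\<forall>d\<in>set ds. 0 < d)"

definition block_offset :: "nat list \<Rightarrow> nat \<Rightarrow> nat" where
  "block_offset ds i = sum_list (take i ds)"

definition block_indices :: "nat list \<Rightarrow> nat \<Rightarrow> nat set" where
  "block_indices ds i = {block_offset ds i ..< block_offset ds i + ds ! i}"

definition block_vec :: "nat list \<Rightarrow> real vec \<Rightarrow> nat \<Rightarrow> real vec" where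
  "block_vec ds x i = vec (ds ! i) (\<lambda>j. x $ (block_offset ds i + j))"

(* A_Gamma, the submatrix formed by the column blocks with index in Gamma. *)
definition block_submatrix :: "nat list \<Rightarrow> real mat \<Rightarrow> nat set \<Rightarrow> real mat" where
  "block_submatrix ds A \<Gamma> = submatrix A UNIV (\<Union>i\<in>\<Gamma>. block_indices ds i)"

definition block_mat :: "nat list \<Rightarrow> real mat \<Rightarrow> nat \<Rightarrow> real mat" where
  "block_mat ds A i = block_submatrix ds A {i}"

definition block_supp :: "nat list \<Rightarrow> real vec \<Rightarrow> nat set" where
  "block_supp ds x = {i. i < length ds \<and> 0 < l2norm (block_vec ds x i)}"

definition block_sparse :: "nat list \<Rightarrow> nat \<Rightarrow> real vec \<Rightarrow> bool" where
  "block_sparse ds K x \<longleftrightarrow> card (block_supp ds x) \<le> K"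

definition block_RIP_const :: "nat list \<Rightarrow> real mat \<Rightarrow> nat \<Rightarrow> real \<Rightarrow> bool" where
  "block_RIP_const ds A K \<delta> \<longleftrightarrow> 0 \<le> \<delta> \<and> \<delta> < 1 \<and>
     (\<forall>x \<in> carrier_vec (sum_list ds). block_sparse ds K x \<longrightarrow>
        (1 - \<delta>) * (l2norm x)\<^sup>2 \<le> (l2norm (A *\<^sub>v x))\<^sup>2 \<and>
        (l2norm (A *\<^sub>v x))\<^sup>2 \<le> (1 + \<delta>) * (l2norm x)\<^sup>2)"

definition block_RIP :: "nat list \<Rightarrow> real mat \<Rightarrow> nat \<Rightarrow> bool" where
  "block_RIP ds A K \<longleftrightarrow> (\<exists>\<delta>. block_RIP_const ds A K \<delta>)"

(* Meaningful only if block_RIP ds A K holds. *)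
definition block_RIC :: "nat list \<Rightarrow> real mat \<Rightarrow> nat \<Rightarrow> real" where
  "block_RIC ds A K = (LEAST \<delta>. block_RIP_const ds A K \<delta>)"

(* S is an admissible choice of N block indices with the N largest values of |A'[i] r|_2.
   Ties make the choice non-unique, so the algorithm is modelled as a relation. *)
definition bommp_select ::
  "nat list \<Rightarrow> real mat \<Rightarrow> nat \<Rightarrow> real vec \<Rightarrow> nat set \<Rightarrow> bool" where
  "bommp_select ds A N r S \<longleftrightarrow>
     S \<subseteq> {..<length ds} \<and> card S = N \<and>
     (\<forall>i\<in>S. \<forall>j\<in>{..<length ds} - S.
        l2norm (transpose_mat (block_mat ds A j) *\<^sub>v r)
          \<le> l2norm (transpose_mat (block_mat ds A i) *\<^sub>v r))"

definition bommp_continue :: "real mat \<Rightarrow> nat \<Rightarrow> real \<Rightarrow> real vec \<Rightarrow> nat \<Rightarrow> bool" where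
  "bommp_continue A K \<epsilon> r k \<longleftrightarrow>
     l2norm r > \<epsilon> \<and> real k < min (real K) (real (dim_row A) / real K)"

primrec bommp_index_set :: "(nat \<Rightarrow> nat set) \<Rightarrow> nat \<Rightarrow> nat set" where
  "bommp_index_set T 0 = {}"
| "bommp_index_set T (Suc k) = bommp_index_set T k \<union> T (Suc k)"

(* A complete execution on input y that leaves the loop after k iterations: T j, u j and r j are
   the selected indices, the estimate and the residual of iteration j (1 <= j <= k), and r 0 is
   the initial residual. Other values of T, u and r are irrelevant. *)
definition bommp_run ::
  "nat list \<Rightarrow> real mat \<Rightarrow> real vec \<Rightarrow> nat \<Rightarrow> nat \<Rightarrow> real \<Rightarrow>
   (nat \<Rightarrow> nat set) \<Rightarrow> (nat \<Rightarrow> real vec) \<Rightarrow> (nat \<Rightarrow> real vec) \<Rightarrow> nat \<Rightarrow> bool" where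
  "bommp_run ds A y K N \<epsilon> T u r k \<longleftrightarrow>
     r 0 = y \<and>
     (\<forall>j<k.
        let B = block_submatrix ds A (bommp_index_set T (Suc j)) in
        bommp_continue A K \<epsilon> (r j) j \<and>
        bommp_select ds A N (r j) (T (Suc j)) \<and>
        is_arg_min (\<lambda>v. l2norm (y - B *\<^sub>v v)) (\<lambda>v. v \<in> carrier_vec (dim_col B)) (u (Suc j)) \<and>
        r (Suc j) = y - B *\<^sub>v u (Suc j)) \<and>
     \<not> bommp_continue A K \<epsilon> (r k) k"

(* z is an output for the final index set L. The block support of z has to equal L, so the feasible
   set need not be closed, and there may be no output at all. *)
definition bommp_output ::
  "nat list \<Rightarrow> real mat \<Rightarrow> real vec \<Rightarrow> nat set \<Rightarrow> real vec \<Rightarrow> bool" where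
  "bommp_output ds A y L z \<longleftrightarrow>
     is_arg_min (\<lambda>v. l2norm (y - A *\<^sub>v v))
       (\<lambda>v. v \<in> carrier_vec (sum_list ds) \<and> block_supp ds v = L) z"

(* Some execution on the noiseless data A x, for some resolution of the ties, goes wrong: one of
   its identification steps picks no block of the support of x, and x is not its output.
   The first clause records an actual selection error: for N > 1 the second one alone can hold
   merely because superfluous indices were added to a correct support. *)
definition bommp_may_fail ::
  "nat list \<Rightarrow> real mat \<Rightarrow> real vec \<Rightarrow> nat \<Rightarrow> nat \<Rightarrow> bool" where
  "bommp_may_fail ds A x K N \<longleftrightarrow>
     (\<exists>T u r k. bommp_run ds A (A *\<^sub>v x) K N 0 T u r k \<and>
        (\<exists>j\<in>{1..k}. T j \<inter> block_supp ds x = {}) \<and>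
        \<not> bommp_output ds A (A *\<^sub>v x) (bommp_index_set T k) x)"

end

theory Submission
  imports Defs "Jordan_Normal_Form.Determinant"
begin

text \<open>
  The argument is two-dimensional. Let \<open>s\<close> and \<open>w\<close> be the normalised indicators of the leading
  coordinates of \<open>K\<close> correct and of \<open>N\<close> wrong blocks, \<open>\<delta>\<^sup>2 = N / (K + N)\<close> and \<open>t\<^sup>2 = 1 - \<delta>\<^sup>2\<close>.
  The matrix \<open>A = I + s g\<close> with the row vector \<open>g = (t - 1) s + \<delta> w\<close> acts as \<open>[[t, \<delta>], [0, 1]]\<close> on
  the span of \<open>s, w\<close> and as the identity on its orthogonal complement. On this span \<open>A' A - I\<close> is \<open>\<delta>\<close>
  times a reflection, so its eigenvalues are \<open>\<delta>\<close> and \<open>-\<delta>\<close>, and eigenvectors have block sparsity at most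
  \<open>K + N \<le> N K + 1\<close>. For the signal \<open>s\<close>, the vector \<open>A' A s = t\<^sup>2 s + t \<delta> w\<close> takes the same value on the
  correct and on the wrong blocks; this tie lets the first step select the wrong ones. Once a wrong
  block is selected it stays in the index set, so \<open>s\<close> is not an output. That the run can be
  completed at all rests on the solvability of the least squares problems, as \<open>A\<close> is injective.
\<close>

subsection \<open>Least squares\<close>

lemma scalar_prod_self_nonneg: "0 \<le> (v :: real vec) \<bullet> v"
  by (simp add: scalar_prod_def sum_nonneg)

lemma scalar_prod_self_eq_0_iff:
  assumes "(v :: real vec) \<in> carrier_vec n"
  shows "v \<bullet> v = 0 \<longleftrightarrow> v = 0\<^sub>v n"
proof
  assume "v \<bullet> v = 0"
  then have "\<forall>i\<in>{0..<n}. v $ i * v $ i = 0"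
    using assms by (subst (asm) scalar_prod_def, subst (asm) sum_nonneg_eq_0_iff) auto
  then show "v = 0\<^sub>v n" using assms by (intro eq_vecI) auto
qed (use assms in simp)

lemma l2norm_sq: "(l2norm v)\<^sup>2 = v \<bullet> v"
  by (simp add: l2norm_def scalar_prod_self_nonneg)

lemma l2norm_le_iff: "l2norm v \<le> l2norm w \<longleftrightarrow> v \<bullet> v \<le> w \<bullet> w"
  by (simp add: l2norm_def)

lemma scalar_prod_self_add:
  assumes "(v :: real vec) \<in> carrier_vec n" "w \<in> carrier_vec n"
  shows "(v + w) \<bullet> (v + w) = v \<bullet> v + 2 * (v \<bullet> w) + w \<bullet> w"
  using assms comm_scalar_prod[OF assms]
  by (simp add: add_scalar_prod_distrib[of _ n] scalar_prod_add_distrib[of _ n])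

text \<open>Injectivity makes the Gram matrix \<open>transpose_mat B * B\<close> nonsingular, so the
  normal equations have a solution; its residual is orthogonal to the range of \<open>B\<close>,
  hence minimal.\<close>

lemma least_squares_exists:
  fixes B :: "real mat"
  assumes B: "B \<in> carrier_mat m n" and y: "y \<in> carrier_vec m"
    and inj: "\<And>v. v \<in> carrier_vec n \<Longrightarrow> B *\<^sub>v v = 0\<^sub>v m \<Longrightarrow> v = 0\<^sub>v n"
  shows "\<exists>u. is_arg_min (\<lambda>v. l2norm (y - B *\<^sub>v v)) (\<lambda>v. v \<in> carrier_vec n) u"
proof -
  let ?G = "transpose_mat B * B"
  have G: "?G \<in> carrier_mat n n" using B by auto
  have Bt: "transpose_mat B \<in> carrier_mat n m" using B by auto
  have "det ?G \<noteq> 0"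
  proof
    assume "det ?G = 0"
    then obtain v where v: "v \<in> carrier_vec n" "v \<noteq> 0\<^sub>v n" "?G *\<^sub>v v = 0\<^sub>v n"
      using det_0_iff_vec_prod_zero_field[OF G] by auto
    have Bv: "B *\<^sub>v v \<in> carrier_vec m" using B v by auto
    have "(B *\<^sub>v v) \<bullet> (B *\<^sub>v v) = (transpose_mat B *\<^sub>v (B *\<^sub>v v)) \<bullet> v"
      using transpose_vec_mult_scalar[OF B v(1) Bv] by simp
    also have "\<dots> = 0"
      unfolding assoc_mult_mat_vec[OF Bt B v(1), symmetric] v(3) using v(1) by simp
    finally show False using inj v scalar_prod_self_eq_0_iff[OF Bv] by blast
  qed
  from det_non_zero_imp_unit[OF G this, of "()"]
  obtain C where C: "C \<in> carrier_mat n n" "?G * C = 1\<^sub>m n"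
    unfolding Units_def ring_mat_def by auto
  define u where "u = C *\<^sub>v (transpose_mat B *\<^sub>v y)"
  have Bty: "transpose_mat B *\<^sub>v y \<in> carrier_vec n" by (rule mult_mat_vec_carrier[OF Bt y])
  have u: "u \<in> carrier_vec n" unfolding u_def by (rule mult_mat_vec_carrier[OF C(1) Bty])
  have Bu: "B *\<^sub>v u \<in> carrier_vec m" by (rule mult_mat_vec_carrier[OF B u])
  have "?G *\<^sub>v u = transpose_mat B *\<^sub>v y"
    unfolding u_def assoc_mult_mat_vec[OF G C(1) Bty, symmetric] C(2) using Bty by simp
  then have normal: "transpose_mat B *\<^sub>v (y - B *\<^sub>v u) = 0\<^sub>v n"
    unfolding mult_minus_distrib_mat_vec[OF Bt y Bu] assoc_mult_mat_vec[OF Bt B u, symmetric]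
    using Bty by simp
  have "l2norm (y - B *\<^sub>v u) \<le> l2norm (y - B *\<^sub>v v)" if v: "v \<in> carrier_vec n" for v
  proof -
    let ?r = "y - B *\<^sub>v u" and ?e = "B *\<^sub>v (u - v)"
    have r: "?r \<in> carrier_vec m" using y Bu by simp
    have e: "?e \<in> carrier_vec m" using u v by (intro mult_mat_vec_carrier[OF B]) simp
    have Bv: "B *\<^sub>v v \<in> carrier_vec m" by (rule mult_mat_vec_carrier[OF B v])
    \<comment> \<open>Pythagoras: any other residual differs from \<open>?r\<close> by a vector in
      the range of \<open>B\<close>, which is orthogonal to \<open>?r\<close>.\<close>
    have "y - B *\<^sub>v v = ?r + ?e"
      unfolding mult_minus_distrib_mat_vec[OF B u v]
      using y Bu Bv by (intro eq_vecI) auto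
    moreover have "?r \<bullet> ?e = 0"
      using transpose_vec_mult_scalar[OF B _ r, of "u - v"] u v normal by simp
    ultimately show ?thesis
      by (simp add: l2norm_le_iff scalar_prod_self_add[OF r e] scalar_prod_self_nonneg)
  qed
  then show ?thesis using u unfolding is_arg_min_linorder by blast
qed

section \<open>Injectivity of column submatrices\<close>

lemma submatrix_cols_carrier:
  assumes "A \<in> carrier_mat m n"
  shows "submatrix A UNIV J \<in> carrier_mat m (card {j. j < n \<and> j \<in> J})"
  using assms by (auto simp: dim_submatrix)

text \<open>A kernel vector of the submatrix, extended by zero to the columns outside
  \<open>J\<close>, is a kernel vector of \<open>A\<close>.\<close>

lemma submatrix_cols_inj:
  fixes A :: "real mat"
  assumes A: "A \<in> carrier_mat m n"
    and inj: "\<And>v. v \<in> carrier_vec n \<Longrightarrow> A *\<^sub>v v = 0\<^sub>v m \<Longrightarrow> v = 0\<^sub>v n"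
    and v: "v \<in> carrier_vec (card {j. j < n \<and> j \<in> J})"
    and Bv: "submatrix A UNIV J *\<^sub>v v = 0\<^sub>v m"
  shows "v = 0\<^sub>v (card {j. j < n \<and> j \<in> J})"
proof -
  let ?J = "{j. j < n \<and> j \<in> J}"
  let ?c = "card ?J"
  \<comment> \<open>The zero extension of \<open>v\<close>: \<open>card {a \<in> J. a < k}\<close>
    is the rank of \<open>k\<close> in \<open>J\<close>, so it inverts
    \<open>pick J\<close>.\<close>
  define w where "w = vec n (\<lambda>k. if k \<in> J then v $ card {a \<in> J. a < k} else 0)"
  have pick: "pick J j \<in> J" "pick J j < n" "card {a \<in> J. a < pick J j} = j" if "j < ?c" for j
  proof -
    have c: "j < card J \<or> infinite J"
    proof (cases "finite J")
      case True
      then have "card ?J \<le> card J" by (intro card_mono) auto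
      then show ?thesis using that by simp
    qed simp
    show "pick J j \<in> J" using pick_in_set[OF c] .
    show "pick J j < n" using pick_le[OF that] .
    show "card {a \<in> J. a < pick J j} = j" using card_pick[OF c] .
  qed
  have card_lt: "card {a \<in> J. a < k} < ?c" if "k \<in> ?J" for k
    using that by (intro psubset_card_mono) auto
  have bij: "bij_betw (pick J) {0..<?c} ?J"
    by (rule bij_betwI[where g = "\<lambda>k. card {a \<in> J. a < k}"])
      (simp_all add: Pi_iff pick card_lt pick_card_in_set)
  have "A *\<^sub>v w = 0\<^sub>v m"
  proof (rule eq_vecI)
    fix i assume i: "i < dim_vec (0\<^sub>v m :: real vec)"
    have "(A *\<^sub>v w) $ i = (\<Sum>k\<in>{0..<n}. A $$ (i, k) * (if k \<in> J then v $ card {a \<in> J. a < k} else 0))"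
      using A i by (auto simp: w_def scalar_prod_def intro!: sum.cong)
    also have "\<dots> = (\<Sum>k\<in>?J. A $$ (i, k) * v $ card {a \<in> J. a < k})"
      by (rule sum.mono_neutral_cong_right) auto
    also have "\<dots> = (\<Sum>j\<in>{0..<?c}. A $$ (i, pick J j) * v $ j)"
      by (subst sum.reindex_bij_betw[OF bij, symmetric]) (auto simp: pick intro!: sum.cong)
    also have "\<dots> = (submatrix A UNIV J *\<^sub>v v) $ i"
      using A i v by (auto simp: scalar_prod_def dim_submatrix submatrix_index pick_UNIV intro!: sum.cong)
    finally show "(A *\<^sub>v w) $ i = 0\<^sub>v m $ i" using Bv by simp
  qed (use A in simp)
  then have w0: "w = 0\<^sub>v n" using inj[of w] by (simp add: w_def)
  show ?thesis
  proof (rule eq_vecI)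
    fix j assume "j < dim_vec (0\<^sub>v ?c :: real vec)"
    then have j: "j < ?c" by simp
    have "v $ j = w $ pick J j" using pick[OF j] by (simp add: w_def)
    then show "v $ j = 0\<^sub>v ?c $ j" using w0 pick[OF j] j by simp
  qed (use v in simp)
qed

subsection \<open>Existence of complete runs\<close>

text \<open>Greedy choice: a maximiser of \<open>f\<close> on the remaining elements dominates all
  that are left after it.\<close>

lemma top_subset_exists:
  fixes f :: "'a \<Rightarrow> real"
  assumes "finite I" "N \<le> card I"
  shows "\<exists>S\<subseteq>I. card S = N \<and> (\<forall>i\<in>S. \<forall>j\<in>I - S. f j \<le> f i)"
  using assms(2)
proof (induction N)
  case 0
  then show ?case by (intro exI[of _ "{}"]) auto
next
  case (Suc N)
  then obtain S where S: "S \<subseteq> I" "card S = N" "\<forall>i\<in>S. \<forall>j\<in>I - S. f j \<le> f i" by auto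
  have "I - S \<noteq> {}" using Suc.prems S card_mono[of S I] assms(1) finite_subset[of S I]
    by (metis Diff_eq_empty_iff not_less_eq_eq)
  then obtain i where i: "i \<in> I - S" "\<And>j. j \<in> I - S \<Longrightarrow> f j \<le> f i"
    using assms(1) Max_in[of "f ` (I - S)"] Max_ge[of "f ` (I - S)"]
    by (metis (no_types, lifting) finite_Diff finite_imageI image_iff image_is_empty imageI)
  then show ?case
    using S finite_subset[OF S(1) assms(1)] by (intro exI[of _ "insert i S"]) auto
qed

lemma bommp_select_exists:
  "N \<le> length ds \<Longrightarrow> \<exists>S. bommp_select ds A N r S"
  using top_subset_exists[of "{..<length ds}" N
      "\<lambda>i. l2norm (transpose_mat (block_mat ds A i) *\<^sub>v r)"]
  by (auto simp: bommp_select_def)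

text \<open>Ties are resolved by a selection function of the current index set, so that a run is
  obtained by recursion; the first selection can be prescribed.\<close>

lemma bommp_run_exists:
  fixes A :: "real mat" and y :: "real vec"
  assumes N: "1 \<le> N" "N \<le> length ds"
    and min_ex: "\<And>\<Gamma>. let B = block_submatrix ds A \<Gamma> in
        \<exists>u. is_arg_min (\<lambda>v. l2norm (y - B *\<^sub>v v)) (\<lambda>v. v \<in> carrier_vec (dim_col B)) u"
    and W: "bommp_select ds A N y W"
    and cont: "bommp_continue A K \<epsilon> y 0"
  shows "\<exists>T u r k. bommp_run ds A y K N \<epsilon> T u r k \<and> 1 \<le> k \<and> T 1 = W"
proof -
  define B where "B = block_submatrix ds A"
  obtain ls where ls: "\<And>\<Gamma>. is_arg_min (\<lambda>v. l2norm (y - B \<Gamma> *\<^sub>v v))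
      (\<lambda>v. v \<in> carrier_vec (dim_col (B \<Gamma>))) (ls \<Gamma>)"
    using min_ex unfolding Let_def B_def by metis
  define res where "res L = (if L = {} then y else y - B L *\<^sub>v ls L)" for L
  obtain sel where sel: "\<And>L. bommp_select ds A N (res L) (sel L)" and sel0: "sel {} = W"
  proof -
    have "\<forall>L. \<exists>S. bommp_select ds A N (res L) S"
      using bommp_select_exists[OF N(2)] by blast
    from choice[OF this] obtain sel where sel: "\<And>L. bommp_select ds A N (res L) (sel L)"
      by blast
    \<comment> \<open>Overriding the choice at \<open>{}\<close> affects the first iteration only:
      since \<open>N\<close> is positive, all later index sets are nonempty.\<close>
    have "bommp_select ds A N (res L) ((sel({} := W)) L)" for L
      using sel[of L] W by (cases "L = {}") (simp_all add: res_def)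
    then show thesis by (rule that) simp
  qed
  define L where "L = rec_nat {} (\<lambda>_ L. L \<union> sel L)"
  have L: "L 0 = {}" "\<And>j. L (Suc j) = L j \<union> sel (L j)" by (auto simp: L_def)
  \<comment> \<open>Selections are numbered from 1: the \<open>j\<close>-th one is made from the
    index set of the first \<open>j - 1\<close> iterations.\<close>
  define T where "T j = sel (L (j - 1))" for j
  have idx: "bommp_index_set T j = L j" for j
    by (induction j) (auto simp: L T_def)
  have "sel M \<noteq> {}" for M using sel[of M] N(1) by (auto simp: bommp_select_def)
  then have ne: "L (Suc j) \<noteq> {}" for j by (auto simp: L)
  \<comment> \<open>The stopping time exists because the loop condition fails at iteration
    \<open>K\<close> at the latest.\<close>
  define k where "k = (LEAST k. \<not> bommp_continue A K \<epsilon> (res (L k)) k)"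
  have "\<not> bommp_continue A K \<epsilon> (res (L K)) K" by (simp add: bommp_continue_def)
  then have k: "\<not> bommp_continue A K \<epsilon> (res (L k)) k"
    unfolding k_def by (rule LeastI)
  have lt_k: "bommp_continue A K \<epsilon> (res (L j)) j" if "j < k" for j
    using not_less_Least[OF that[unfolded k_def]] by simp
  have "k \<noteq> 0" using k cont by (metis L(1) res_def)
  moreover have "T 1 = W" by (simp add: T_def L sel0)
  moreover have "bommp_run ds A y K N \<epsilon> T (\<lambda>j. ls (L j)) (\<lambda>j. res (L j)) k"
    unfolding bommp_run_def Let_def idx
    using k lt_k sel ls ne by (auto simp: T_def L(1) res_def B_def)
  ultimately show ?thesis by (metis One_nat_def Suc_leI not_gr0)
qed

subsection \<open>Block coordinates\<close>

lemma block_offset_Suc: "i < length ds \<Longrightarrow> block_offset ds (Suc i) = block_offset ds i + ds ! i"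
  by (simp add: block_offset_def take_Suc_conv_app_nth)

lemma block_offset_mono: "i \<le> j \<Longrightarrow> block_offset ds i \<le> block_offset ds j"
  unfolding block_offset_def
  by (metis append_take_drop_id le_add1 le_Suc_ex sum_list.append take_add)

lemma block_end_le:
  assumes "i < length ds"
  shows "block_offset ds i + ds ! i \<le> sum_list ds"
  using block_offset_mono[of "Suc i" "length ds" ds] assms
  by (simp add: block_offset_Suc) (simp add: block_offset_def)

lemma block_index_lt:
  assumes "i < length ds" "k < ds ! i"
  shows "block_offset ds i + k < sum_list ds"
  using block_end_le[OF assms(1)] assms(2) by simp

text \<open>Blocks occupy disjoint intervals, and positive sizes keep their starting points
  distinct.\<close>

lemma block_offset_eq_iff:
  assumes "block_structure ds" "i < length ds" "j < length ds" "k < ds ! j"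
  shows "block_offset ds i = block_offset ds j + k \<longleftrightarrow> i = j \<and> k = 0"
proof -
  have pos: "0 < ds ! i" using assms by (auto simp: block_structure_def)
  consider "i < j" | "i = j" | "j < i" by linarith
  then show ?thesis
  proof cases
    case 1
    then have "block_offset ds (Suc i) \<le> block_offset ds j" by (intro block_offset_mono) simp
    then show ?thesis using 1 pos assms by (simp add: block_offset_Suc)
  next
    case 3
    then have "block_offset ds (Suc j) \<le> block_offset ds i" by (intro block_offset_mono) simp
    then show ?thesis using 3 assms by (simp add: block_offset_Suc)
  qed simp
qed

lemma inj_on_block_offset:
  assumes "block_structure ds"
  shows "inj_on (block_offset ds) {..<length ds}"
proof (rule inj_onI)
  fix i j assume "i \<in> {..<length ds}" "j \<in> {..<length ds}" "block_offset ds i = block_offset ds j"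
  moreover from this have "0 < ds ! j" using assms by (auto simp: block_structure_def)
  ultimately show "i = j" using block_offset_eq_iff[OF assms, of i j 0] by simp
qed

lemma pick_atLeastLessThan: "k < d \<Longrightarrow> pick {a..<a + d} k = a + k"
proof -
  assume k: "k < d"
  have "{x \<in> {a..<a + d}. x < a + k} = {a..<a + k}" using k by auto
  then show ?thesis using pick_card_in_set[of "a + k" "{a..<a + d}"] k by simp
qed

text \<open>Lets the correlations of all blocks be read off from one vector. The columns of a block
  form an interval, on which \<open>pick\<close> is a shift.\<close>

lemma transpose_block_mat_mult_vec:
  assumes A: "A \<in> carrier_mat m (sum_list ds)" and r: "r \<in> carrier_vec m" and i: "i < length ds"
  shows "transpose_mat (block_mat ds A i) *\<^sub>v r = block_vec ds (transpose_mat A *\<^sub>v r) i"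
proof -
  let ?I = "{block_offset ds i..<block_offset ds i + ds ! i}"
  have "{j. j < sum_list ds \<and> j \<in> ?I} = ?I"
    using block_end_le[OF i] by auto
  then have card: "card {j. j < sum_list ds \<and> j \<in> ?I} = ds ! i" by simp
  have row: "card {j. j < m \<and> j \<in> UNIV} = m" by simp
  have B: "block_mat ds A i = submatrix A UNIV ?I"
    by (simp add: block_mat_def block_submatrix_def block_indices_def)
  have dims: "dim_row (block_mat ds A i) = m" "dim_col (block_mat ds A i) = ds ! i"
    using A card row by (simp_all only: B dim_submatrix carrier_matD)
  have entry: "block_mat ds A i $$ (a, k) = A $$ (a, block_offset ds i + k)"
    if "a < m" "k < ds ! i" for a k
    using A card row that
    by (simp only: B submatrix_index carrier_matD pick_UNIV pick_atLeastLessThan)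
  show ?thesis
  proof (rule eq_vecI)
    fix k assume "k < dim_vec (block_vec ds (transpose_mat A *\<^sub>v r) i)"
    then have k: "k < ds ! i" by (simp add: block_vec_def)
    then show "(transpose_mat (block_mat ds A i) *\<^sub>v r) $ k
        = block_vec ds (transpose_mat A *\<^sub>v r) i $ k"
      using A r block_index_lt[OF i k]
      by (auto simp: dims entry block_vec_def scalar_prod_def intro!: sum.cong)
  qed (simp add: dims block_vec_def)
qed

text \<open>Using one coordinate per block makes the construction work for arbitrary block sizes, as
  if all blocks had size 1.\<close>

definition block_heads :: "nat list \<Rightarrow> nat set \<Rightarrow> real vec" where
  "block_heads ds X = vec (sum_list ds) (\<lambda>k. if k \<in> block_offset ds ` X then 1 else 0)"

lemma block_heads_carrier [simp]: "block_heads ds X \<in> carrier_vec (sum_list ds)"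
  by (simp add: block_heads_def)

lemma block_heads_scalar_prod:
  assumes "block_structure ds" "X \<subseteq> {..<length ds}" "Y \<subseteq> {..<length ds}"
  shows "block_heads ds X \<bullet> block_heads ds Y = real (card (X \<inter> Y))"
proof -
  have lt: "block_offset ds i < sum_list ds" if "i < length ds" for i
    using block_index_lt[OF that, of 0] assms(1) that by (auto simp: block_structure_def)
  have "block_heads ds X \<bullet> block_heads ds Y =
      (\<Sum>k\<in>{0..<sum_list ds}. if k \<in> block_offset ds ` X \<inter> block_offset ds ` Y then 1 else 0)"
    unfolding block_heads_def scalar_prod_def by (auto intro!: sum.cong)
  also have "\<dots> = real (card ({0..<sum_list ds} \<inter> (block_offset ds ` X \<inter> block_offset ds ` Y)))"
    by (subst sum.inter_restrict[symmetric]) simp_all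
  also have "{0..<sum_list ds} \<inter> (block_offset ds ` X \<inter> block_offset ds ` Y) = block_offset ds ` (X \<inter> Y)"
    using assms lt inj_on_image_Int[OF inj_on_block_offset[OF assms(1)], of X Y] by auto
  also have "card (block_offset ds ` (X \<inter> Y)) = card (X \<inter> Y)"
    using assms(2) by (intro card_image inj_on_subset[OF inj_on_block_offset[OF assms(1)]]) auto
  finally show ?thesis .
qed

lemma block_heads_nth:
  assumes "block_structure ds" "X \<subseteq> {..<length ds}" "i < length ds" "k < ds ! i"
  shows "block_heads ds X $ (block_offset ds i + k) = (if i \<in> X \<and> k = 0 then 1 else 0)"
proof -
  have "block_offset ds i + k \<in> block_offset ds ` X \<longleftrightarrow> i \<in> X \<and> k = 0"
    using block_offset_eq_iff[OF assms(1) _ assms(3,4)] assms(2)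
    by (auto simp: image_iff subset_iff) (metis add.right_neutral)+
  then show ?thesis using block_index_lt[OF assms(3,4)] by (simp add: block_heads_def)
qed

lemma l2norm_block_vec_heads:
  assumes "block_structure ds" "X \<subseteq> {..<length ds}" "Y \<subseteq> {..<length ds}" "i < length ds"
  shows "l2norm (block_vec ds (a \<cdot>\<^sub>v block_heads ds X + b \<cdot>\<^sub>v block_heads ds Y) i)
    = \<bar>(if i \<in> X then a else 0) + (if i \<in> Y then b else 0)\<bar>"
proof -
  let ?c = "(if i \<in> X then a else 0) + (if i \<in> Y then b else 0)"
  let ?v = "block_vec ds (a \<cdot>\<^sub>v block_heads ds X + b \<cdot>\<^sub>v block_heads ds Y) i"
  have pos: "0 < ds ! i" using assms by (auto simp: block_structure_def)
  have entry: "?v $ k = (if k = 0 then ?c else 0)" if "k < ds ! i" for k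
    using that block_index_lt[OF assms(4) that] block_heads_nth[OF assms(1) _ assms(4) that] assms(2,3)
    by (simp add: block_vec_def block_heads_def)
  have dim: "dim_vec ?v = ds ! i" by (simp add: block_vec_def)
  have "?v \<bullet> ?v = (\<Sum>k\<in>{0..<ds ! i}. if k = 0 then ?c\<^sup>2 else 0)"
    unfolding scalar_prod_def dim
    by (rule sum.cong) (simp_all only: entry power2_eq_square atLeastLessThan_iff split: if_split, simp)
  also have "\<dots> = ?c\<^sup>2" using pos by simp
  finally show ?thesis by (simp add: l2norm_def)
qed

text \<open>Only an inclusion, since coefficients may vanish or cancel on the overlap of
  \<open>X\<close> and \<open>Y\<close>.\<close>

lemma block_supp_heads:
  assumes "block_structure ds" "X \<subseteq> {..<length ds}" "Y \<subseteq> {..<length ds}"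
  shows "block_supp ds (a \<cdot>\<^sub>v block_heads ds X + b \<cdot>\<^sub>v block_heads ds Y) \<subseteq> X \<union> Y"
  using l2norm_block_vec_heads[OF assms] by (auto simp: block_supp_def split: if_splits)

subsection \<open>The extremal matrix\<close>

text \<open>For \<open>s\<close> and \<open>g\<close> of equal dimension, the rank-one perturbation
  \<open>I + s g'\<close> of the identity.\<close>

definition shear_mat :: "real vec \<Rightarrow> real vec \<Rightarrow> real mat" where
  "shear_mat s g = mat (dim_vec s) (dim_vec g) (\<lambda>(i, j). (if i = j then 1 else 0) + s $ i * g $ j)"

lemma shear_mat_carrier:
  "s \<in> carrier_vec n \<Longrightarrow> g \<in> carrier_vec n \<Longrightarrow> shear_mat s g \<in> carrier_mat n n"
  by (simp add: shear_mat_def)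

lemma transpose_shear_mat: "transpose_mat (shear_mat s g) = shear_mat g s"
  by (rule eq_matI) (auto simp: shear_mat_def)

lemma shear_mat_mult_vec:
  assumes "s \<in> carrier_vec n" "g \<in> carrier_vec n" "v \<in> carrier_vec n"
  shows "shear_mat s g *\<^sub>v v = v + (g \<bullet> v) \<cdot>\<^sub>v s"
proof (rule eq_vecI)
  fix i assume "i < dim_vec (v + (g \<bullet> v) \<cdot>\<^sub>v s)"
  then have i: "i < n" using assms by simp
  have "(shear_mat s g *\<^sub>v v) $ i = (\<Sum>j\<in>{0..<n}. ((if i = j then 1 else 0) + s $ i * g $ j) * v $ j)"
    using assms i by (auto simp: shear_mat_def scalar_prod_def intro!: sum.cong)
  also have "\<dots> = (\<Sum>j\<in>{0..<n}. (if i = j then v $ j else 0) + g $ j * v $ j * s $ i)"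
    by (rule sum.cong) (auto simp: algebra_simps)
  also have "\<dots> = v $ i + (g \<bullet> v) * s $ i"
    using assms i by (simp add: sum.distrib sum_distrib_right scalar_prod_def)
  finally show "(shear_mat s g *\<^sub>v v) $ i = (v + (g \<bullet> v) \<cdot>\<^sub>v s) $ i"
    using assms i by simp
qed (use assms in \<open>simp add: shear_mat_def\<close>)

locale orthonormal_pair =
  fixes n :: nat and s w :: "real vec"
  assumes s [simp]: "s \<in> carrier_vec n" and w [simp]: "w \<in> carrier_vec n"
    and ss [simp]: "s \<bullet> s = 1" and ww [simp]: "w \<bullet> w = 1" and sw [simp]: "s \<bullet> w = 0"
begin

lemma ws [simp]: "w \<bullet> s = 0"
  using comm_scalar_prod[OF s w] by simp

lemma dims [simp]: "dim_vec s = n" "dim_vec w = n"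
  using s w by auto

lemma scalar_prod_combination_left:
  "v \<in> carrier_vec n \<Longrightarrow> (a \<cdot>\<^sub>v s + b \<cdot>\<^sub>v w) \<bullet> v = a * (s \<bullet> v) + b * (w \<bullet> v)"
  by (simp add: add_scalar_prod_distrib[of _ n])

lemma scalar_prod_combination:
  "s \<bullet> (a \<cdot>\<^sub>v s + b \<cdot>\<^sub>v w) = a" "w \<bullet> (a \<cdot>\<^sub>v s + b \<cdot>\<^sub>v w) = b"
  by (simp_all add: scalar_prod_add_distrib[of _ n])

lemma bessel:
  assumes v: "v \<in> carrier_vec n"
  shows "(s \<bullet> v)\<^sup>2 + (w \<bullet> v)\<^sup>2 \<le> v \<bullet> v"
proof -
  \<comment> \<open>\<open>v + ?p\<close> is the component of \<open>v\<close> orthogonal to the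
    plane of \<open>s\<close> and \<open>w\<close>; its squared norm is nonnegative.\<close>
  let ?p = "(- (s \<bullet> v)) \<cdot>\<^sub>v s + (- (w \<bullet> v)) \<cdot>\<^sub>v w"
  have p: "?p \<in> carrier_vec n" by simp
  have "?p \<bullet> ?p = (s \<bullet> v)\<^sup>2 + (w \<bullet> v)\<^sup>2"
    by (simp only: scalar_prod_combination_left[OF p] scalar_prod_combination) (simp add: power2_eq_square)
  moreover have "v \<bullet> ?p = - (s \<bullet> v)\<^sup>2 - (w \<bullet> v)\<^sup>2"
    by (simp only: comm_scalar_prod[OF v p] scalar_prod_combination_left[OF v]) (simp add: power2_eq_square)
  ultimately show ?thesis
    using scalar_prod_self_nonneg[of "v + ?p"] unfolding scalar_prod_self_add[OF v p] by simp
qed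

end

locale extremal_shear = orthonormal_pair +
  fixes \<delta> t :: real
  assumes \<delta>: "0 < \<delta>" "\<delta> < 1" and t_sq: "t\<^sup>2 = 1 - \<delta>\<^sup>2"
begin

definition g :: "real vec" where
  "g = (t - 1) \<cdot>\<^sub>v s + \<delta> \<cdot>\<^sub>v w"

definition A :: "real mat" where
  "A = shear_mat s g"

lemma g_carrier [simp]: "g \<in> carrier_vec n"
  by (simp add: g_def)

lemma A_carrier: "A \<in> carrier_mat n n"
  by (simp add: A_def shear_mat_carrier)

lemma A_mult_vec: "v \<in> carrier_vec n \<Longrightarrow> A *\<^sub>v v = v + (g \<bullet> v) \<cdot>\<^sub>v s"
  by (simp add: A_def shear_mat_mult_vec[of _ n])

lemma A_mult_s: "A *\<^sub>v s = t \<cdot>\<^sub>v s"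
proof -
  have gs: "g \<bullet> s = t - 1" by (simp add: g_def scalar_prod_combination_left)
  show ?thesis unfolding A_mult_vec[OF s] gs by (intro eq_vecI) (auto simp: algebra_simps)
qed

text \<open>The blocks of this vector are the correlations that decide the first identification step
  for the signal \<open>s\<close>.\<close>

lemma transpose_A_mult_A_mult_s:
  "transpose_mat A *\<^sub>v (A *\<^sub>v s) = t\<^sup>2 \<cdot>\<^sub>v s + (t * \<delta>) \<cdot>\<^sub>v w"
proof -
  have "transpose_mat A *\<^sub>v (A *\<^sub>v s) = t \<cdot>\<^sub>v s + (s \<bullet> (t \<cdot>\<^sub>v s)) \<cdot>\<^sub>v g"
    unfolding A_mult_s unfolding A_def transpose_shear_mat by (rule shear_mat_mult_vec[of _ n]) simp_all
  also have "\<dots> = t\<^sup>2 \<cdot>\<^sub>v s + (t * \<delta>) \<cdot>\<^sub>v w"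
    by (intro eq_vecI) (auto simp: g_def power2_eq_square algebra_simps)
  finally show ?thesis .
qed

text \<open>\<open>A\<close> replaces the coordinate \<alpha> of \<open>v\<close> along
  \<open>s\<close> by t \<alpha> + \<delta> \<beta>, with \<beta> the one along \<open>w\<close>,
  and changes nothing orthogonal to \<open>s\<close>.\<close>

lemma A_norm_sq:
  assumes v: "v \<in> carrier_vec n"
  shows "(A *\<^sub>v v) \<bullet> (A *\<^sub>v v) = v \<bullet> v
    + \<delta> * (\<delta> * ((w \<bullet> v)\<^sup>2 - (s \<bullet> v)\<^sup>2) + 2 * t * (s \<bullet> v) * (w \<bullet> v))"
proof -
  define \<alpha> \<beta> where "\<alpha> = s \<bullet> v" and "\<beta> = w \<bullet> v"
  have gv: "g \<bullet> v = (t - 1) * \<alpha> + \<delta> * \<beta>"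
    by (simp add: g_def scalar_prod_combination_left[OF v] \<alpha>_def \<beta>_def)
  have dim: "dim_vec v = n" using v by simp
  have vs: "v \<bullet> s = \<alpha>" using comm_scalar_prod[OF v s] by (simp add: \<alpha>_def)
  have "(A *\<^sub>v v) \<bullet> (A *\<^sub>v v) = v \<bullet> v + 2 * ((g \<bullet> v) * \<alpha>) + (g \<bullet> v)\<^sup>2"
    using v dim by (simp add: A_mult_vec scalar_prod_self_add[of _ n] vs power2_eq_square)
  also have "\<dots> = v \<bullet> v + (t\<^sup>2 - 1) * \<alpha>\<^sup>2 + 2 * t * \<delta> * \<alpha> * \<beta> + \<delta>\<^sup>2 * \<beta>\<^sup>2"
    unfolding gv by (simp add: power2_eq_square algebra_simps)
  also have "\<dots> = v \<bullet> v + \<delta> * (\<delta> * (\<beta>\<^sup>2 - \<alpha>\<^sup>2) + 2 * t * \<alpha> * \<beta>)"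
    unfolding t_sq by (simp add: power2_eq_square algebra_simps)
  finally show ?thesis by (simp add: \<alpha>_def \<beta>_def)
qed

text \<open>The matrix \<open>[[-\<delta>, t], [t, \<delta>]]\<close> of this quadratic form is orthogonal because \<open>\<delta>\<^sup>2 + t\<^sup>2 = 1\<close>.\<close>

lemma reflection_bound:
  "\<bar>\<delta> * (\<beta>\<^sup>2 - \<alpha>\<^sup>2) + 2 * t * \<alpha> * \<beta>\<bar> \<le> \<alpha>\<^sup>2 + \<beta>\<^sup>2"
proof -
  let ?q = "\<delta> * (\<beta>\<^sup>2 - \<alpha>\<^sup>2) + 2 * t * \<alpha> * \<beta>"
  \<comment> \<open>Because (1 + \<delta>)(1 - \<delta>) is the square of \<open>t\<close>, the
    factor 1 + \<delta> turns both forms to be bounded into perfect squares.\<close>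
  have sq: "((1 + \<delta>) * x + t * z)\<^sup>2 = (1 + \<delta>) * ((1 + \<delta>) * x\<^sup>2 + 2 * t * x * z + (1 - \<delta>) * z\<^sup>2)" for x z
  proof -
    have "((1 + \<delta>) * x + t * z)\<^sup>2 = (1 + \<delta>)\<^sup>2 * x\<^sup>2 + 2 * (1 + \<delta>) * t * x * z + t\<^sup>2 * z\<^sup>2"
      by (simp add: power2_eq_square algebra_simps)
    then show ?thesis unfolding t_sq by (simp add: power2_eq_square algebra_simps)
  qed
  have "(1 + \<delta>) * (\<alpha>\<^sup>2 + \<beta>\<^sup>2 - ?q) = ((1 + \<delta>) * \<alpha> + t * (- \<beta>))\<^sup>2"
    "(1 + \<delta>) * (\<alpha>\<^sup>2 + \<beta>\<^sup>2 + ?q) = ((1 + \<delta>) * \<beta> + t * \<alpha>)\<^sup>2"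
    unfolding sq by (simp_all add: power2_eq_square algebra_simps)
  then have "0 \<le> (1 + \<delta>) * (\<alpha>\<^sup>2 + \<beta>\<^sup>2 - ?q)" "0 \<le> (1 + \<delta>) * (\<alpha>\<^sup>2 + \<beta>\<^sup>2 + ?q)"
    by simp_all
  then have "0 \<le> \<alpha>\<^sup>2 + \<beta>\<^sup>2 - ?q" "0 \<le> \<alpha>\<^sup>2 + \<beta>\<^sup>2 + ?q"
    using \<delta>(1) by (simp_all add: zero_le_mult_iff)
  then show ?thesis by linarith
qed

text \<open>Bessel's inequality reduces this to the plane of \<open>s\<close> and \<open>w\<close>.
  Being free of sparsity, the bound serves every order and also gives injectivity.\<close>

lemma A_norm_bounds:
  assumes v: "v \<in> carrier_vec n"
  shows "\<bar>(A *\<^sub>v v) \<bullet> (A *\<^sub>v v) - v \<bullet> v\<bar> \<le> \<delta> * (v \<bullet> v)"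
proof -
  have "\<bar>\<delta> * ((w \<bullet> v)\<^sup>2 - (s \<bullet> v)\<^sup>2) + 2 * t * (s \<bullet> v) * (w \<bullet> v)\<bar> \<le> v \<bullet> v"
    using reflection_bound bessel[OF v] by (rule order_trans)
  then show ?thesis using \<delta>(1) by (simp add: A_norm_sq[OF v] abs_mult)
qed

lemma A_inj:
  assumes v: "v \<in> carrier_vec n" and Av: "A *\<^sub>v v = 0\<^sub>v n"
  shows "v = 0\<^sub>v n"
proof -
  have "v \<bullet> v \<le> \<delta> * (v \<bullet> v)" using A_norm_bounds[OF v] scalar_prod_self_nonneg[of v] by (simp add: Av)
  then have "(1 - \<delta>) * (v \<bullet> v) \<le> 0" by (simp add: algebra_simps)
  then have "v \<bullet> v = 0" using \<delta>(2) scalar_prod_self_nonneg[of v] by (simp add: mult_le_0_iff)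
  then show ?thesis using scalar_prod_self_eq_0_iff[OF v] by blast
qed

text \<open>The coordinates (t, 1 + \<delta>) are fixed by the reflection
  \<open>[[-\<delta>, t], [t, \<delta>]]\<close>, so the upper isometry bound is attained at
  \<open>v\<close>.\<close>

lemma A_norm_extremal:
  defines "v \<equiv> t \<cdot>\<^sub>v s + (1 + \<delta>) \<cdot>\<^sub>v w"
  shows "v \<bullet> v = 2 * (1 + \<delta>)" "(A *\<^sub>v v) \<bullet> (A *\<^sub>v v) = (1 + \<delta>) * (v \<bullet> v)"
proof -
  have v: "v \<in> carrier_vec n" by (simp add: v_def)
  have sv: "s \<bullet> v = t" and wv: "w \<bullet> v = 1 + \<delta>" unfolding v_def by (rule scalar_prod_combination)+
  have "v \<bullet> v = t * (s \<bullet> v) + (1 + \<delta>) * (w \<bullet> v)"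
    using scalar_prod_combination_left[OF v, of t "1 + \<delta>"] by (simp add: v_def)
  then show vv: "v \<bullet> v = 2 * (1 + \<delta>)" unfolding sv wv using t_sq by (simp add: power2_eq_square algebra_simps)
  have "2 * t * t * (1 + \<delta>) = 2 * t\<^sup>2 * (1 + \<delta>)" by (simp add: power2_eq_square)
  then show "(A *\<^sub>v v) \<bullet> (A *\<^sub>v v) = (1 + \<delta>) * (v \<bullet> v)"
    unfolding A_norm_sq[OF v] vv sv wv
    by (simp only: t_sq) (simp add: power2_eq_square algebra_simps)
qed

text \<open>The extremal vector, once sparse enough to be tested, forces every constant up to
  \<delta>; conversely the bounds hold for all vectors.\<close>

lemma block_RIP_const_iff:
  assumes n: "n = sum_list ds" and sparse: "block_sparse ds M (t \<cdot>\<^sub>v s + (1 + \<delta>) \<cdot>\<^sub>v w)"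
  shows "block_RIP_const ds A M \<delta>' \<longleftrightarrow> \<delta> \<le> \<delta>' \<and> \<delta>' < 1"
proof
  let ?v = "t \<cdot>\<^sub>v s + (1 + \<delta>) \<cdot>\<^sub>v w"
  assume L: "block_RIP_const ds A M \<delta>'"
  have "(A *\<^sub>v ?v) \<bullet> (A *\<^sub>v ?v) \<le> (1 + \<delta>') * (?v \<bullet> ?v)"
    using L sparse unfolding block_RIP_const_def l2norm_sq n[symmetric] by simp
  then have "(1 + \<delta>) * (2 * (1 + \<delta>)) \<le> (1 + \<delta>') * (2 * (1 + \<delta>))"
    unfolding A_norm_extremal(2) unfolding A_norm_extremal(1) .
  then have "\<delta> \<le> \<delta>'" using \<delta>(1) by (simp add: mult_le_cancel_right)
  then show "\<delta> \<le> \<delta>' \<and> \<delta>' < 1" using L by (simp add: block_RIP_const_def)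
next
  assume R: "\<delta> \<le> \<delta>' \<and> \<delta>' < 1"
  have "(1 - \<delta>') * (v \<bullet> v) \<le> (A *\<^sub>v v) \<bullet> (A *\<^sub>v v) \<and> (A *\<^sub>v v) \<bullet> (A *\<^sub>v v) \<le> (1 + \<delta>') * (v \<bullet> v)"
    if v: "v \<in> carrier_vec n" for v
  proof -
    have "\<delta> * (v \<bullet> v) \<le> \<delta>' * (v \<bullet> v)"
      using R by (simp add: mult_right_mono scalar_prod_self_nonneg)
    then have "\<bar>(A *\<^sub>v v) \<bullet> (A *\<^sub>v v) - v \<bullet> v\<bar> \<le> \<delta>' * (v \<bullet> v)" using A_norm_bounds[OF v] by linarith
    then show ?thesis unfolding left_diff_distrib distrib_right mult_1 by linarith
  qed
  then show "block_RIP_const ds A M \<delta>'"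
    using R \<delta> unfolding block_RIP_const_def l2norm_sq n[symmetric] by simp
qed

lemma block_RIC_eq:
  assumes "n = sum_list ds" "block_sparse ds M (t \<cdot>\<^sub>v s + (1 + \<delta>) \<cdot>\<^sub>v w)"
  shows "block_RIP ds A M" "block_RIC ds A M = \<delta>"
proof -
  note iff = block_RIP_const_iff[OF assms]
  show "block_RIP ds A M" unfolding block_RIP_def iff using \<delta>(2) by blast
  show "block_RIC ds A M = \<delta>"
    unfolding block_RIC_def iff using \<delta>(2) by (intro Least_equality) simp_all
qed

lemma bommp_may_fail_s:
  assumes KN: "0 < K" "K \<le> n" "1 \<le> N" "N \<le> length ds" and t: "t \<noteq> 0"
    and W: "bommp_select ds A N (A *\<^sub>v s) W" "W \<inter> block_supp ds s = {}"
  shows "bommp_may_fail ds A s K N"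
proof -
  have y: "A *\<^sub>v s \<in> carrier_vec n" by (simp add: A_mult_s)
  have min_ex: "let B = block_submatrix ds A \<Gamma> in
    \<exists>u. is_arg_min (\<lambda>v. l2norm (A *\<^sub>v s - B *\<^sub>v v)) (\<lambda>v. v \<in> carrier_vec (dim_col B)) u" for \<Gamma>
  proof -
    let ?J = "\<Union>i\<in>\<Gamma>. block_indices ds i"
    note B = submatrix_cols_carrier[OF A_carrier, of ?J]
    show ?thesis
      unfolding Let_def block_submatrix_def carrier_matD(2)[OF B]
      by (rule least_squares_exists[OF B y submatrix_cols_inj[OF A_carrier A_inj]])
  qed
  \<comment> \<open>The loop is entered: the data are nonzero, and \<open>K \<le> n\<close> makes
    the iteration bound positive.\<close>
  have "0 < l2norm (A *\<^sub>v s)" using t by (simp add: A_mult_s l2norm_def)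
  then have "bommp_continue A K 0 (A *\<^sub>v s) 0"
    using KN A_carrier by (simp add: bommp_continue_def)
  from bommp_run_exists[OF KN(3,4) min_ex W(1) this]
  obtain T u r k where run: "bommp_run ds A (A *\<^sub>v s) K N 0 T u r k" "1 \<le> k" "T 1 = W" by blast
  \<comment> \<open>The wrong blocks of the first step stay in the final index set, which an output
    must have as its block support.\<close>
  have "W \<noteq> {}" using W(1) KN(3) by (auto simp: bommp_select_def)
  moreover have "T j \<subseteq> bommp_index_set T k" if "1 \<le> j" "j \<le> k" for j
    using that(2,1) by (induction k) (auto simp: le_Suc_eq)
  ultimately have "block_supp ds s \<noteq> bommp_index_set T k" using run W(2) by force
  then have "\<not> bommp_output ds A (A *\<^sub>v s) (bommp_index_set T k) s"
    by (simp add: bommp_output_def is_arg_min_def)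
  then show ?thesis
    using run W(2) unfolding bommp_may_fail_def by (metis atLeastAtMost_iff order_refl)
qed

end

section \<open>Choice of blocks and constants, and the tie\<close>

theorem theorem3p4:
  fixes K N :: nat and ds :: "nat list"
  assumes "1 \<le> N" and "N \<le> K"
    and "block_structure ds" and "N * K + 1 \<le> length ds"
  shows "\<exists>m A x.
      A \<in> carrier_mat m (sum_list ds) \<and> x \<in> carrier_vec (sum_list ds) \<and>
      real N \<le> real m / real K \<and>
      block_sparse ds K x \<and>
      block_RIP ds A (N * K + 1) \<and>
      block_RIC ds A (N * K + 1) = 1 / sqrt (real K / real N + 1) \<and>
      bommp_may_fail ds A x K N"
proof -
  define S W where "S = {..<K}" and "W = {K..<K + N}"
  let ?n = "sum_list ds"
  let ?HS = "block_heads ds S" and ?HW = "block_heads ds W"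
  define s w where "s = (1 / sqrt K) \<cdot>\<^sub>v ?HS" and "w = (1 / sqrt N) \<cdot>\<^sub>v ?HW"
  \<comment> \<open>The ratio of \<delta> to \<open>t\<close> is that of \<open>sqrt N\<close> to
    \<open>sqrt K\<close>, which offsets the normalisations of \<open>w\<close> and \<open>s\<close>
    and creates the tie.\<close>
  define \<delta> t where "\<delta> = sqrt N / sqrt (K + N)" and "t = sqrt K / sqrt (K + N)"
  have K: "0 < K" using assms by simp
  \<comment> \<open>This is (N - 1)(K - 1) \<ge> 0. It makes the extremal vector sparse enough for
    order \<open>N * K + 1\<close> and lets both families of blocks fit.\<close>
  have KN: "K + N \<le> N * K + 1"
  proof -
    obtain N' K' where "N = Suc N'" "K = Suc K'" using assms(1) K by (metis Suc_le_D One_nat_def gr0_conv_Suc)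
    then show ?thesis by simp
  qed
  \<comment> \<open>Blocks are nonempty, so the square matrix has enough rows for \<open>N\<close>
    to be at most \<open>m / K\<close>.\<close>
  have "length ds \<le> ?n"
    using assms(3) by (induction ds) (auto simp: block_structure_def Suc_le_eq)
  then have n: "N * K + 1 \<le> ?n" using assms(4) by simp
  have sub: "S \<subseteq> {..<length ds}" "W \<subseteq> {..<length ds}"
    using KN assms(4) by (auto simp: S_def W_def)
  have disj: "S \<inter> W = {}" "W \<inter> S = {}" and card: "card S = K" "card W = N"
    by (auto simp: S_def W_def)
  have inner: "?HS \<bullet> ?HS = K" "?HW \<bullet> ?HW = N" "?HS \<bullet> ?HW = 0"
    using sub by (simp_all add: block_heads_scalar_prod[OF assms(3)] card disj)
  have \<delta>_sq: "\<delta>\<^sup>2 = N / (K + N)" and t_frac: "t\<^sup>2 = K / (K + N)"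
    by (simp_all add: \<delta>_def t_def power_divide)
  interpret extremal_shear ?n s w \<delta> t
  proof
    show "s \<in> carrier_vec ?n" "w \<in> carrier_vec ?n" by (simp_all add: s_def w_def)
    have dims: "dim_vec ?HS = ?n" "dim_vec ?HW = ?n" by (simp_all add: block_heads_def)
    show "s \<bullet> s = 1" "w \<bullet> w = 1" "s \<bullet> w = 0"
      using K assms(1) by (simp_all add: s_def w_def dims inner)
    show "0 < \<delta>" "\<delta> < 1" using K assms(1) by (simp_all add: \<delta>_def)
    show "t\<^sup>2 = 1 - \<delta>\<^sup>2" using K by (simp add: \<delta>_sq t_frac field_simps)
  qed
  have combination: "a \<cdot>\<^sub>v s + b \<cdot>\<^sub>v w = (a / sqrt K) \<cdot>\<^sub>v ?HS + (b / sqrt N) \<cdot>\<^sub>v ?HW" for a b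
    by (simp add: s_def w_def smult_smult_assoc)
  have "s = 1 \<cdot>\<^sub>v s + 0 \<cdot>\<^sub>v w" by (intro eq_vecI) auto
  then have "block_supp ds s = block_supp ds ((1 / sqrt K) \<cdot>\<^sub>v ?HS + 0 \<cdot>\<^sub>v ?HW)"
    using combination[of 1 0] by simp
  also have "\<dots> = S"
    using l2norm_block_vec_heads[OF assms(3) sub, of _ "1 / sqrt K" 0] sub K
    by (auto simp: block_supp_def split: if_splits)
  finally have supp: "block_supp ds s = S" .
  have "block_supp ds (t \<cdot>\<^sub>v s + (1 + \<delta>) \<cdot>\<^sub>v w) \<subseteq> S \<union> W"
    unfolding combination by (rule block_supp_heads[OF assms(3) sub])
  then have "card (block_supp ds (t \<cdot>\<^sub>v s + (1 + \<delta>) \<cdot>\<^sub>v w)) \<le> card (S \<union> W)"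
    by (rule card_mono[rotated]) (simp add: S_def W_def)
  also have "\<dots> \<le> N * K + 1" using card_Un_le[of S W] card KN by simp
  finally have sparse: "block_sparse ds (N * K + 1) (t \<cdot>\<^sub>v s + (1 + \<delta>) \<cdot>\<^sub>v w)"
    by (simp add: block_sparse_def)
  \<comment> \<open>The common value of the correlations on \<open>S\<close> and on
    \<open>W\<close>.\<close>
  define c where "c = t\<^sup>2 / sqrt K"
  have c: "t * \<delta> / sqrt N = c"
  proof -
    have "t * \<delta> / sqrt N = sqrt K / (K + N)" using assms(1) by (simp add: t_def \<delta>_def)
    also have "\<dots> = K / sqrt K / (K + N)" by (simp add: real_div_sqrt)
    finally show ?thesis by (simp add: c_def t_frac)
  qed
  have "transpose_mat A *\<^sub>v (A *\<^sub>v s) = c \<cdot>\<^sub>v ?HS + c \<cdot>\<^sub>v ?HW"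
    unfolding transpose_A_mult_A_mult_s combination c c_def[symmetric] ..
  then have corr: "l2norm (transpose_mat (block_mat ds A i) *\<^sub>v (A *\<^sub>v s))
      = \<bar>(if i \<in> S then c else 0) + (if i \<in> W then c else 0)\<bar>" if "i < length ds" for i
    using transpose_block_mat_mult_vec[OF A_carrier _ that] l2norm_block_vec_heads[OF assms(3) sub that]
    by (simp add: A_mult_s)
  \<comment> \<open>Every block of \<open>W\<close> attains the maximal correlation, so
    \<open>W\<close> is an admissible choice although \<open>S\<close> ties with it.\<close>
  have "bommp_select ds A N (A *\<^sub>v s) W"
  proof -
    have "l2norm (transpose_mat (block_mat ds A i) *\<^sub>v (A *\<^sub>v s)) = \<bar>c\<bar>" if "i \<in> W" for i
    proof -
      have "i < length ds" "i \<notin> S" using that sub(2) disj by auto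
      then show ?thesis using corr[of i] that by simp
    qed
    moreover have "l2norm (transpose_mat (block_mat ds A j) *\<^sub>v (A *\<^sub>v s)) \<le> \<bar>c\<bar>"
      if "j < length ds" "j \<notin> W" for j
      using corr that by simp
    ultimately show ?thesis unfolding bommp_select_def using sub(2) card(2) by auto
  qed
  moreover have "t \<noteq> 0" "N \<le> length ds" "K \<le> ?n"
    using K KN assms(4) n by (auto simp: t_def)
  ultimately have fail: "bommp_may_fail ds A s K N"
    using K assms(1) disj(2) by (intro bommp_may_fail_s[of K N ds W]) (simp_all add: supp)
  have "real N * real K \<le> real ?n" using n by (metis add_leD1 of_nat_le_iff of_nat_mult)
  then have "real N \<le> real ?n / real K" using K by (simp add: le_divide_eq)
  moreover have "\<delta> = 1 / sqrt (real K / real N + 1)"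
  proof -
    have "real K / real N + 1 = (K + N) / N" using assms(1) by (simp add: field_simps)
    then show ?thesis by (simp add: \<delta>_def real_sqrt_divide)
  qed
  ultimately show ?thesis
    using A_carrier fail block_RIC_eq[OF refl sparse] supp card
    by (intro exI[of _ ?n] exI[of _ A] exI[of _ s]) (simp add: block_sparse_def)
qed

end
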